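(* Let $\mu$ be the uniform distribution on $[0,1]^d$, let $Y_1,\dots,Y_n$ be $n$ distinct points of $\mathbb{R}^d$, and let $P_n=\sum_{k=1}^n\pi_k\delta_{Y_k}$ be a probability measure with $\pi_k>0$ for all $k$ and $\sum_k\pi_k=1$. For $w=(w_1,\dots,w_n)\in\mathbb{R}^n$ put $w^*(u)=\max_{1\le k\le n}\{\langle u,Y_k\rangle-w_k\}$, $u\in\mathbb{R}^d$, and $\Phi_\mu(w)=\int w^*(u)\,d\mu(u)$. Then there exist weights $w=(w_1,\dots,w_n)\in\mathbb{R}^n$, unique up to an additive constant, such that the gradient map $\varphi=\nabla w^*$ satisfies: (i) for almost all $u\in[0,1]^d$, $\varphi(u)\in\{Y_1,\dots,Y_n\}$; (ii) for all $k\in\{1,\dots,n\}$, $\mu(\varphi^{-1}\{Y_k\})=\pi_k$, i.e. $\varphi$ pushes $\mu$ forward to $P_n$; (iii) $\varphi=\nabla V$ for a convex function $V:\mathbb{R}^d\to\mathbb{R}$. Moreover, the function $v\mapsto\Phi_\mu(v)+\sum_{k=1}^n\pi_kv_k$ on $\mathbb{R}^n$ is convex, and it reaches its minimum at any weight vector $w=(w_1,\dots,w_n)$ for which the gradient map $\varphi=\nabla w^*$ satisfies (i), (ii) and (iii).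
   Context: $\langle\cdot,\cdot\rangle$ is the standard scalar product on $\mathbb{R}^d$. "Unique up to an additive constant" means unique up to replacing $(w_1,\dots,w_n)$ by $(w_1+c,\dots,w_n+c)$ with $c\in\mathbb{R}$. The gradient of a convex function is defined Lebesgue-almost everywhere. *)

theory Defs
  imports "HOL-Probability.Probability"
begin

definition unif_cube :: "(real ^ 'd) measure" where
  "unif_cube = uniform_measure lborel {u. \<forall>i. 0 \<le> u $ i \<and> u $ i \<le> 1}"

definition discrete_measure :: "('n::finite \<Rightarrow> real) \<Rightarrow> ('n \<Rightarrow> real ^ 'd) \<Rightarrow> (real ^ 'd) measure" where
  "discrete_measure p Y =
     measure_of UNIV (sets borel) (\<lambda>A. \<Sum>k\<in>UNIV. ennreal (p k) * emeasure (return borel (Y k)) A)"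

text \<open>The value at points where \<open>f\<close> is not differentiable is a fixed unspecified vector;
  for convex \<open>f\<close> this concerns only a Lebesgue null set.\<close>

definition gradient :: "('a::real_inner \<Rightarrow> real) \<Rightarrow> 'a \<Rightarrow> 'a" where
  "gradient f u = (THE D. GDERIV f u :> D)"

definition wstar :: "('n::finite \<Rightarrow> real ^ 'd) \<Rightarrow> real ^ 'n \<Rightarrow> real ^ 'd \<Rightarrow> real" where
  "wstar Y w u = (MAX k. u \<bullet> Y k - w $ k)"

definition Phi :: "(real ^ 'd) measure \<Rightarrow> ('n::finite \<Rightarrow> real ^ 'd) \<Rightarrow> real ^ 'n \<Rightarrow> real" where
  "Phi \<mu> Y w = (LINT u|\<mu>. wstar Y w u)"

text \<open>Equality of gradient maps is equality Lebesgue-almost everywhere, and the last clause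
  includes that \<open>V\<close> is differentiable almost everywhere.\<close>

definition transport_weights :: "('n::finite \<Rightarrow> real) \<Rightarrow> ('n \<Rightarrow> real ^ 'd) \<Rightarrow> real ^ 'n \<Rightarrow> bool" where
  "transport_weights p Y w \<longleftrightarrow>
     (let \<phi> = gradient (wstar Y w) in
       (AE u in unif_cube. \<phi> u \<in> range Y) \<and>
       (\<forall>k. measure unif_cube (\<phi> -` {Y k}) = p k) \<and>
       (\<exists>V. convex_on UNIV V \<and> (AE u in lborel. GDERIV V u :> \<phi> u)))"

lemma emeasure_discrete_measure:
  fixes Y :: "'n::finite \<Rightarrow> real ^ 'd"
  assumes "A \<in> sets borel"
  shows "emeasure (discrete_measure p Y) A = (\<Sum>k\<in>UNIV. ennreal (p k) * indicator A (Y k))"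
proof -
  have "emeasure (discrete_measure p Y) A =
      (\<Sum>k\<in>UNIV. ennreal (p k) * emeasure (return borel (Y k)) A)"
  proof (rule emeasure_measure_of[OF discrete_measure_def])
    show "positive (sets (discrete_measure p Y))
        (\<lambda>A. \<Sum>k\<in>UNIV. ennreal (p k) * emeasure (return borel (Y k)) A)"
      by (simp add: positive_def)
    have s: "sets (discrete_measure p Y) = sets borel"
      unfolding discrete_measure_def using sets.sigma_sets_eq[of "borel :: (real ^ 'd) measure"] by simp
    show "countably_additive (sets (discrete_measure p Y))
        (\<lambda>A. \<Sum>k\<in>UNIV. ennreal (p k) * emeasure (return borel (Y k)) A)"
      unfolding countably_additive_def s
    proof (intro allI impI)
      fix B :: "nat \<Rightarrow> (real ^ 'd) set"
      assume B: "range B \<subseteq> sets borel" "disjoint_family B" "\<Union> (range B) \<in> sets borel"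
      have "(\<Sum>i. \<Sum>k\<in>UNIV. ennreal (p k) * emeasure (return borel (Y k)) (B i)) =
          (\<Sum>k\<in>UNIV. \<Sum>i. ennreal (p k) * emeasure (return borel (Y k)) (B i))"
        by (rule suminf_sum) simp
      also have "\<dots> = (\<Sum>k\<in>UNIV. ennreal (p k) * emeasure (return borel (Y k)) (\<Union> (range B)))"
        using B by (intro sum.cong refl, subst ennreal_suminf_cmult, subst suminf_emeasure) (simp_all only: sets_return)
      finally show "(\<Sum>i. \<Sum>k\<in>UNIV. ennreal (p k) * emeasure (return borel (Y k)) (B i)) =
          (\<Sum>k\<in>UNIV. ennreal (p k) * emeasure (return borel (Y k)) (\<Union> (range B)))" .
    qed
    show "A \<in> sets (discrete_measure p Y)" using assms s by simp
  qed auto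
  then show ?thesis using assms by simp
qed

end

theory Submission
  imports Defs
begin

text \<open>
  Write \<open>C\<^sub>k(w)\<close> for the open cell on which \<open>\<langle>u, Y\<^sub>k\<rangle> - w\<^sub>k\<close> is the strict maximum; the cells
  cover the space up to finitely many hyperplanes, and \<open>w\<^sup>*\<close> has gradient \<open>Y\<^sub>k\<close> on \<open>C\<^sub>k(w)\<close> and no
  gradient outside the cells. So \<open>w\<close> is a solution iff \<open>\<mu>(C\<^sub>k(w)) = p\<^sub>k\<close> for all \<open>k\<close>.
  Integrating \<open>v\<^sup>*(u) \<ge> \<langle>u, Y\<^sub>k\<rangle> - v\<^sub>k = w\<^sup>*(u) - (v\<^sub>k - w\<^sub>k)\<close> over \<open>u \<in> C\<^sub>k(w)\<close> shows that
  \<open>p\<^sub>k - \<mu>(C\<^sub>k(w))\<close> are the entries of a subgradient at \<open>w\<close> of the functional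
  \<open>F(w) = \<Phi>(w) + \<Sum> p\<^sub>k w\<^sub>k\<close>. Hence solutions minimise \<open>F\<close>. Conversely \<open>F\<close> has a minimiser \<open>w\<close>
  by coercivity modulo constants; comparing it with \<open>w + t e\<^sub>k\<close> for \<open>t \<down> 0\<close> gives
  \<open>\<mu>(C\<^sub>k(w)) \<le> p\<^sub>k\<close>, and both sides sum to 1.

  If \<open>v\<close>, \<open>w\<close> are solutions and \<open>v - w\<close> is not constant, let \<open>S\<close> be the set of indices where \<open>v - w\<close>
  is minimal. Passing from \<open>w\<close> to \<open>v\<close> enlarges the region won by \<open>S\<close> by a strip along its
  boundary. This strip meets the open cube because the cube is connected, so it has positive
  measure, contradicting that the region has mass \<open>\<Sum>\<^bsub>k\<in>S\<^esub> p\<^sub>k\<close> both times.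
\<close>

subsection \<open>Maxima of affine functions\<close>

text \<open>These are the open Laguerre (power) cells of the sites \<open>Y k\<close>. Strict
  inequalities make them open and pairwise disjoint, leaving ties in no cell.\<close>

definition cell :: "('n \<Rightarrow> real ^ 'd) \<Rightarrow> real ^ 'n \<Rightarrow> 'n \<Rightarrow> (real ^ 'd) set" where
  "cell Y w k = {u. \<forall>j. j \<noteq> k \<longrightarrow> u \<bullet> Y j - w $ j < u \<bullet> Y k - w $ k}"

lemma wstar_ge: "u \<bullet> Y k - w $ k \<le> wstar Y w u"
  unfolding wstar_def by (rule Max_ge) auto

lemma wstar_le: "(\<And>k. u \<bullet> Y k - w $ k \<le> b) \<Longrightarrow> wstar Y w u \<le> b"
  unfolding wstar_def by (subst Max_le_iff) auto

lemma wstar_attained: "\<exists>k. wstar Y w u = u \<bullet> Y k - w $ k"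
proof -
  have "wstar Y w u \<in> range (\<lambda>k. u \<bullet> Y k - w $ k)"
    unfolding wstar_def by (rule Max_in) auto
  then show ?thesis by auto
qed

lemma wstar_cell:
  fixes Y :: "'n::finite \<Rightarrow> real ^ 'd"
  assumes "u \<in> cell Y w k"
  shows "wstar Y w u = u \<bullet> Y k - w $ k"
proof (intro antisym wstar_ge wstar_le)
  fix j show "u \<bullet> Y j - w $ j \<le> u \<bullet> Y k - w $ k"
    using assms by (cases "j = k") (auto simp: cell_def less_imp_le)
qed

text \<open>Each function in the maximum is affine in weights and point jointly. The first bound
  yields convexity in the point, the second convexity in the weights.\<close>

lemma wstar_convex_combination:
  assumes "0 \<le> a" "0 \<le> b" "a + b = 1"
  shows "wstar Y (a *\<^sub>R v + b *\<^sub>R w) (a *\<^sub>R x + b *\<^sub>R y) \<le> a * wstar Y v x + b * wstar Y w y"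
    and "wstar Y (a *\<^sub>R v + b *\<^sub>R w) z \<le> a * wstar Y v z + b * wstar Y w z"
proof -
  show gen: "wstar Y (a *\<^sub>R v + b *\<^sub>R w) (a *\<^sub>R x + b *\<^sub>R y) \<le> a * wstar Y v x + b * wstar Y w y" for x y
  proof (rule wstar_le)
    fix k
    have "(a *\<^sub>R x + b *\<^sub>R y) \<bullet> Y k - (a *\<^sub>R v + b *\<^sub>R w) $ k
        = a * (x \<bullet> Y k - v $ k) + b * (y \<bullet> Y k - w $ k)"
      by (simp add: inner_add_left algebra_simps)
    also have "\<dots> \<le> a * wstar Y v x + b * wstar Y w y"
      using assms by (intro add_mono mult_left_mono wstar_ge)
    finally show "(a *\<^sub>R x + b *\<^sub>R y) \<bullet> Y k - (a *\<^sub>R v + b *\<^sub>R w) $ k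
        \<le> a * wstar Y v x + b * wstar Y w y" .
  qed
  show "wstar Y (a *\<^sub>R v + b *\<^sub>R w) z \<le> a * wstar Y v z + b * wstar Y w z"
    using gen[of z z] assms by (simp flip: scaleR_left_distrib)
qed

lemma convex_on_wstar: "convex_on UNIV (wstar Y w)"
proof (rule convex_onI)
  fix t :: real and x y
  assume t: "0 < t" "t < 1"
  have "(1 - t) *\<^sub>R w + t *\<^sub>R w = w" by (simp flip: scaleR_left_distrib)
  then show "wstar Y w ((1 - t) *\<^sub>R x + t *\<^sub>R y) \<le> (1 - t) * wstar Y w x + t * wstar Y w y"
    using wstar_convex_combination(1)[of "1 - t" t Y w w x y] t by simp
qed auto

lemma wstar_shift:
  assumes "\<And>k. v $ k = w $ k + c"
  shows "wstar Y v u = wstar Y w u - c"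
proof (rule antisym)
  have "u \<bullet> Y k - v $ k \<le> wstar Y w u - c" for k
    using wstar_ge[of u Y k w] assms[of k] by linarith
  then show "wstar Y v u \<le> wstar Y w u - c" by (rule wstar_le)
  have "u \<bullet> Y k - w $ k \<le> wstar Y v u + c" for k
    using wstar_ge[of u Y k v] assms[of k] by linarith
  then have "wstar Y w u \<le> wstar Y v u + c" by (rule wstar_le)
  then show "wstar Y w u - c \<le> wstar Y v u" by linarith
qed

lemma cell_shift:
  assumes "\<And>k. v $ k = w $ k + c"
  shows "cell Y v k = cell Y w k"
  unfolding cell_def by (simp add: assms diff_diff_eq[symmetric])

lemma continuous_on_wstar: "continuous_on UNIV (wstar Y w)"
  using convex_on_wstar convex_on_continuous open_UNIV by blast

lemma wstar_measurable [measurable]: "wstar Y w \<in> borel_measurable borel"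
  by (rule borel_measurable_continuous_onI[OF continuous_on_wstar])

lemma open_cell: "open (cell Y w (k :: 'n::finite))"
proof -
  have "cell Y w k = (\<Inter>j\<in>-{k}. {u. u \<bullet> Y j - w $ j < u \<bullet> Y k - w $ k})"
    by (auto simp: cell_def)
  then show ?thesis
    by (auto intro!: open_INT open_Collect_less continuous_intros)
qed

lemma cell_measurable [measurable]: "cell Y w (k :: 'n::finite) \<in> sets borel"
  by (rule borel_open[OF open_cell])

lemma cell_disjoint: "u \<in> cell Y w j \<Longrightarrow> u \<in> cell Y w k \<Longrightarrow> j = k"
  unfolding cell_def by (metis (mono_tags, lifting) mem_Collect_eq less_asym)

lemma sum_indicator_cell:
  fixes Y :: "'n::finite \<Rightarrow> real ^ 'd" and f :: "'n \<Rightarrow> 'a::semiring_1"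
  assumes "u \<in> cell Y w k"
  shows "(\<Sum>j\<in>UNIV. f j * indicator (cell Y w j) u) = f k"
proof -
  have "(\<Sum>j\<in>UNIV. f j * indicator (cell Y w j) u) = (\<Sum>j\<in>UNIV. if j = k then f j else 0)"
    using assms by (intro sum.cong) (auto simp: indicator_def dest: cell_disjoint[OF assms])
  then show ?thesis by simp
qed

text \<open>A maximising index exists; since its cell misses \<open>u\<close>, some other index does
  at least as well and is maximal too.\<close>

lemma ties_outside_cells:
  fixes Y :: "'n::finite \<Rightarrow> real ^ 'd"
  assumes "\<And>k. u \<notin> cell Y w k"
  obtains j k where "j \<noteq> k" "wstar Y w u = u \<bullet> Y j - w $ j" "wstar Y w u = u \<bullet> Y k - w $ k"
proof -
  obtain k where k: "wstar Y w u = u \<bullet> Y k - w $ k" using wstar_attained by blast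
  obtain j where j: "j \<noteq> k" "\<not> u \<bullet> Y j - w $ j < u \<bullet> Y k - w $ k"
    using assms[of k] by (auto simp: cell_def)
  then show ?thesis using k wstar_ge[of u Y j w] by (intro that[of j k]) auto
qed

subsection \<open>The gradient of the dual function\<close>

lemma GDERIV_unique:
  fixes f :: "'a::real_inner \<Rightarrow> real"
  assumes "GDERIV f u :> D" "GDERIV f u :> E"
  shows "D = E"
proof -
  have "(\<lambda>h. h \<bullet> D) = (\<lambda>h. h \<bullet> E)"
    using assms unfolding gderiv_def by (rule has_derivative_unique)
  \<comment> \<open>Both linear maps are evaluated in the direction \<open>D - E\<close>.\<close>
  then have "(D - E) \<bullet> D = (D - E) \<bullet> E" by metis
  then have "(D - E) \<bullet> (D - E) = 0" by (simp add: inner_diff_right)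
  then show ?thesis by simp
qed

lemma gradient_eqI: "GDERIV f u :> D \<Longrightarrow> gradient f u = D"
  unfolding gradient_def by (rule the_equality) (auto intro: GDERIV_unique)

lemma GDERIV_wstar_cell:
  fixes Y :: "'n::finite \<Rightarrow> real ^ 'd"
  assumes "u \<in> cell Y w k"
  shows "GDERIV (wstar Y w) u :> Y k"
proof -
  have "((\<lambda>u. u \<bullet> Y k - w $ k) has_derivative (\<lambda>h. h \<bullet> Y k)) (at u)"
    by (auto intro!: derivative_eq_intros)
  then show ?thesis
    unfolding gderiv_def
    by (rule has_derivative_transform_within_open[OF _ open_cell assms]) (simp add: wstar_cell)
qed

text \<open>The difference of \<open>f\<close> and the affine function has a global minimum at
  \<open>u\<close>, so its derivative there vanishes.\<close>

lemma GDERIV_supporting_affine: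
  fixes f :: "'a::real_inner \<Rightarrow> real"
  assumes "GDERIV f u :> D" and "\<And>x. x \<bullet> y - c \<le> f x" and "f u = u \<bullet> y - c"
  shows "D = y"
proof -
  let ?g = "\<lambda>x. f x - (x \<bullet> y - c)"
  have "(?g has_derivative (\<lambda>h. h \<bullet> D - h \<bullet> y)) (at u)"
    using assms(1) unfolding gderiv_def by (auto intro!: derivative_eq_intros)
  moreover have "eventually (\<lambda>x. ?g u \<le> ?g x) (at u)"
    using assms(2,3) by simp
  ultimately have "(\<lambda>h. h \<bullet> D - h \<bullet> y) = (\<lambda>h. 0)"
    by (rule has_derivative_local_min)
  then have "(D - y) \<bullet> D - (D - y) \<bullet> y = 0" by metis
  then have "(D - y) \<bullet> (D - y) = 0" by (simp add: inner_diff_right)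
  then show ?thesis by simp
qed

text \<open>At a tie two affine functions with different slopes support the maximum, and a gradient
  would have to equal both.\<close>

lemma not_GDERIV_wstar_outside_cells:
  fixes Y :: "'n::finite \<Rightarrow> real ^ 'd"
  assumes "inj Y" "\<And>k. u \<notin> cell Y w k"
  shows "\<not> GDERIV (wstar Y w) u :> D"
proof
  assume D: "GDERIV (wstar Y w) u :> D"
  obtain j k where jk: "j \<noteq> k" "wstar Y w u = u \<bullet> Y j - w $ j" "wstar Y w u = u \<bullet> Y k - w $ k"
    using ties_outside_cells assms(2) by blast
  have "D = Y j" "D = Y k"
    using GDERIV_supporting_affine[OF D wstar_ge] jk by blast+
  then show False using jk(1) assms(1) by (auto dest: injD)
qed

lemma gradient_wstar_cell:
  fixes Y :: "'n::finite \<Rightarrow> real ^ 'd"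
  assumes "u \<in> cell Y w k"
  shows "gradient (wstar Y w) u = Y k"
  using gradient_eqI GDERIV_wstar_cell assms by blast

text \<open>Where no derivative exists, \<^const>\<open>gradient\<close> takes one and the same junk value, so the
  gradient map is Borel measurable and not just measurable up to a null set.\<close>

lemma gradient_wstar_measurable:
  fixes Y :: "'n::finite \<Rightarrow> real ^ 'd"
  assumes "inj Y"
  shows "gradient (wstar Y w) \<in> borel_measurable borel"
proof -
  define c :: "real ^ 'd" where "c = (THE D. False)"
  have "gradient (wstar Y w) u = (if u \<in> (\<Union>k. cell Y w k)
      then \<Sum>k\<in>UNIV. indicator (cell Y w k) u *\<^sub>R Y k else c)" for u
  proof (cases "u \<in> (\<Union>k. cell Y w k)")
    case True
    then obtain k where k: "u \<in> cell Y w k" by blast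
    have "(\<Sum>j\<in>UNIV. indicator (cell Y w j) u *\<^sub>R Y j) = (\<Sum>j\<in>UNIV. if j = k then Y j else 0)"
      using k by (intro sum.cong) (auto simp: indicator_def dest: cell_disjoint[OF k])
    then show ?thesis using True gradient_wstar_cell[OF k] by simp
  next
    case False
    then have "\<And>D. \<not> GDERIV (wstar Y w) u :> D"
      using not_GDERIV_wstar_outside_cells[OF assms] by blast
    then show ?thesis using False by (simp add: gradient_def c_def)
  qed
  then have "gradient (wstar Y w) = (\<lambda>u. if u \<in> (\<Union>k. cell Y w k)
      then \<Sum>k\<in>UNIV. indicator (cell Y w k) u *\<^sub>R Y k else c)" by blast
  moreover have "(\<lambda>u. if u \<in> (\<Union>k. cell Y w k)
      then \<Sum>k\<in>UNIV. indicator (cell Y w k) u *\<^sub>R Y k else c) \<in> borel_measurable borel"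
    by measurable
  ultimately show ?thesis by simp
qed

text \<open>A tie between \<open>j\<close> and \<open>k\<close> puts \<open>u\<close> on a
  hyperplane with normal \<open>Y j - Y k\<close>, nonzero by injectivity. Finitely many hyperplanes
  form a null set.\<close>

lemma AE_cells:
  fixes Y :: "'n::finite \<Rightarrow> real ^ 'd"
  assumes "inj Y"
  shows "AE u in lborel. \<exists>k. u \<in> cell Y w k"
proof -
  let ?H = "\<lambda>j k. {u. (Y j - Y k) \<bullet> u = w $ j - w $ k}"
  let ?N = "\<Union>(j, k)\<in>{(j, k). j \<noteq> k}. ?H j k"
  have "?H j k \<in> null_sets lborel" if "j \<noteq> k" for j k
  proof -
    have "negligible (?H j k)"
      using that assms by (intro negligible_hyperplane) (auto dest: injD)
    moreover have "?H j k \<in> sets borel"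
      by (intro borel_closed closed_hyperplane)
    ultimately show ?thesis
      by (simp add: negligible_iff_null_sets null_sets_completion_iff)
  qed
  then have "?N \<in> null_sets lborel"
    by (intro null_sets_UN' countable_finite) auto
  then show ?thesis
  proof (rule AE_I')
    show "{u \<in> space lborel. \<not> (\<exists>k. u \<in> cell Y w k)} \<subseteq> ?N"
    proof
      fix u assume "u \<in> {u \<in> space lborel. \<not> (\<exists>k. u \<in> cell Y w k)}"
      then obtain j k where "j \<noteq> k" "wstar Y w u = u \<bullet> Y j - w $ j" "wstar Y w u = u \<bullet> Y k - w $ k"
        using ties_outside_cells[of u Y w] by blast
      then show "u \<in> ?N"
        by (force simp: inner_diff_left inner_commute[of _ u])
    qed
  qed
qed

subsection \<open>The uniform distribution on the cube\<close>

lemma unit_cube_eq_cbox: "{u :: real ^ 'd. \<forall>i. 0 \<le> u $ i \<and> u $ i \<le> 1} = cbox 0 1"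
  by (auto simp: mem_box_cart)

lemma emeasure_unit_cube: "emeasure lborel (cbox 0 (1 :: real ^ 'd)) = 1"
proof -
  have "measure lborel (cbox 0 (1 :: real ^ 'd)) = 1"
    by (simp add: content_cbox_if_cart interval_ne_empty_cart)
  then show ?thesis
    using emeasure_eq_ennreal_measure[of lborel "cbox 0 (1 :: real ^ 'd)"] emeasure_lborel_cbox_finite
    by (metis ennreal_1 infinity_ennreal_def order_less_irrefl)
qed

lemma sets_unif_cube [simp, measurable_cong]: "sets (unif_cube :: (real ^ 'd) measure) = sets borel"
  by (simp add: unif_cube_def)

lemma space_unif_cube [simp]: "space (unif_cube :: (real ^ 'd) measure) = UNIV"
  by (simp add: unif_cube_def)

lemma prob_space_unif_cube: "prob_space (unif_cube :: (real ^ 'd) measure)"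
  unfolding unif_cube_def unit_cube_eq_cbox
  by (intro prob_space_uniform_measure) (simp_all add: emeasure_unit_cube)

interpretation unif_cube: prob_space "unif_cube :: (real ^ 'd) measure"
  by (rule prob_space_unif_cube)

lemma emeasure_unif_cube:
  "A \<in> sets borel \<Longrightarrow> emeasure unif_cube A = emeasure lborel (cbox 0 1 \<inter> (A :: (real ^ 'd) set))"
  unfolding unif_cube_def unit_cube_eq_cbox
  by (simp add: emeasure_unit_cube divide_ennreal_def)

lemma AE_unif_cubeI:
  assumes "AE u in lborel. u \<in> cbox 0 1 \<longrightarrow> P (u :: real ^ 'd)"
  shows "AE u in unif_cube. P u"
  unfolding unif_cube_def unit_cube_eq_cbox
  using assms by (intro AE_uniform_measureI) auto

lemma AE_unif_cube_cells:
  fixes Y :: "'n::finite \<Rightarrow> real ^ 'd"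
  assumes "inj Y"
  shows "AE u in unif_cube. \<exists>k. u \<in> cell Y w k"
  by (rule AE_unif_cubeI) (use AE_cells[OF assms, of w] in eventually_elim, simp)

lemma measure_unif_cube_open_pos:
  assumes "open A" "A \<inter> box 0 (1 :: real ^ 'd) \<noteq> {}"
  shows "measure unif_cube A > 0"
proof -
  have "\<not> negligible (A \<inter> box 0 1)"
    using assms by (intro open_not_negligible) (auto intro: open_box)
  moreover have "A \<inter> box 0 1 \<in> sets borel" using assms by auto
  ultimately have "emeasure lborel (A \<inter> box 0 1) \<noteq> 0"
    by (auto simp: negligible_iff_null_sets null_sets_completion_iff intro!: null_setsI)
  moreover have "emeasure lborel (A \<inter> box 0 1) \<le> emeasure unif_cube A"
    using assms box_subset_cbox[of 0 "1 :: real ^ 'd"]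
    by (subst emeasure_unif_cube) (auto intro!: emeasure_mono)
  ultimately have "emeasure unif_cube A > 0"
    by (metis order_less_le_trans zero_less_iff_neq_zero)
  then show ?thesis
    by (simp add: unif_cube.emeasure_eq_measure)
qed

text \<open>The boundary of the cube is a null set, so a set of positive mass must reach the
  interior.\<close>

lemma open_inter_unit_box_nonempty:
  assumes "open A" "measure unif_cube A > 0"
  shows "A \<inter> box 0 (1 :: real ^ 'd) \<noteq> {}"
proof
  assume "A \<inter> box 0 (1 :: real ^ 'd) = {}"
  then have sub: "cbox 0 1 \<inter> A \<subseteq> cbox 0 1 - box 0 (1 :: real ^ 'd)" by auto
  have "negligible (cbox 0 1 - box 0 (1 :: real ^ 'd))"
    by (rule negligible_frontier_interval)
  then have "negligible (cbox 0 1 \<inter> A)" using sub negligible_subset by blast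
  then have "cbox 0 1 \<inter> A \<in> null_sets lborel"
    using assms(1) by (simp add: negligible_iff_null_sets null_sets_completion_iff)
  then have "emeasure unif_cube A = 0"
    using assms(1) by (simp add: emeasure_unif_cube null_setsD1)
  then show False using assms(2) by (simp add: measure_def)
qed

text \<open>If \<open>A\<close> and \<open>B\<close> were disjoint inside the open cube, they would
  disconnect it. So their intersection meets the open cube, and an open set that does so has
  positive mass.\<close>

lemma open_cover_unit_cube_overlap:
  fixes A B :: "(real ^ 'd) set"
  assumes "open A" "open B" "A \<union> B = UNIV" "measure unif_cube A > 0" "measure unif_cube B > 0"
  shows "measure unif_cube (A \<inter> B) > 0"
proof (rule measure_unif_cube_open_pos)
  show "open (A \<inter> B)" using assms by blast
  have "connected (box 0 (1 :: real ^ 'd))" by (simp add: convex_connected)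
  moreover have "A \<inter> box 0 1 \<noteq> {}" "B \<inter> box 0 1 \<noteq> {}"
    using assms open_inter_unit_box_nonempty by blast+
  ultimately show "A \<inter> B \<inter> box 0 1 \<noteq> {}"
    using connectedD[of "box 0 1" A B] assms by blast
qed

lemma AE_unif_cube_bounded_inner:
  fixes y :: "real ^ 'd"
  shows "AE u in unif_cube. \<bar>u \<bullet> y\<bar> \<le> real CARD('d) * norm y"
proof (rule AE_unif_cubeI, rule AE_I2, rule impI)
  fix u :: "real ^ 'd" assume u: "u \<in> cbox 0 1"
  have "norm u \<le> (\<Sum>i\<in>UNIV. \<bar>u $ i\<bar>)" by (rule norm_le_l1_cart)
  also have "\<dots> \<le> (\<Sum>i\<in>(UNIV :: 'd set). 1)"
    using u by (intro sum_mono) (auto simp: mem_box_cart)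
  finally have "norm u \<le> real CARD('d)" by simp
  then show "\<bar>u \<bullet> y\<bar> \<le> real CARD('d) * norm y"
    using Cauchy_Schwarz_ineq2[of u y] by (meson mult_right_mono norm_ge_zero order_trans)
qed

lemma integrable_wstar:
  fixes Y :: "'n::finite \<Rightarrow> real ^ 'd"
  shows "integrable unif_cube (wstar Y w)"
proof (rule unif_cube.integrable_const_bound)
  have "AE u in unif_cube. \<forall>k\<in>UNIV. \<bar>u \<bullet> Y k\<bar> \<le> real CARD('d) * norm (Y k)"
    by (rule AE_finite_allI) (auto intro: AE_unif_cube_bounded_inner)
  then show "AE u in unif_cube. norm (wstar Y w u)
      \<le> (\<Sum>k\<in>UNIV. real CARD('d) * norm (Y k) + \<bar>w $ k\<bar>)"
  proof eventually_elim
    case (elim u)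
    obtain k where k: "wstar Y w u = u \<bullet> Y k - w $ k" using wstar_attained by blast
    have "norm (wstar Y w u) \<le> real CARD('d) * norm (Y k) + \<bar>w $ k\<bar>"
      using elim[rule_format, of k] k by simp
    also have "\<dots> \<le> (\<Sum>k\<in>UNIV. real CARD('d) * norm (Y k) + \<bar>w $ k\<bar>)"
      by (rule member_le_sum[of k UNIV "\<lambda>k. real CARD('d) * norm (Y k) + \<bar>w $ k\<bar>"]) auto
    finally show ?case .
  qed
qed measurable

section \<open>Cell masses and the characterisation of solutions\<close>

lemma sum_measure_cells:
  fixes Y :: "'n::finite \<Rightarrow> real ^ 'd"
  assumes "inj Y"
  shows "(\<Sum>k\<in>UNIV. measure unif_cube (cell Y w k)) = 1"
proof -
  have "(\<Sum>k\<in>UNIV. measure unif_cube (cell Y w k)) = measure unif_cube (\<Union>k. cell Y w k)"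
    by (intro unif_cube.finite_measure_finite_Union[symmetric])
      (auto simp: disjoint_family_on_def dest: cell_disjoint)
  also have "\<dots> = 1"
    using AE_unif_cube_cells[OF assms, of w] by (subst unif_cube.prob_eq_1) auto
  finally show ?thesis .
qed

text \<open>Points in no cell form a null set, so the cells with index in \<open>S\<close> capture
  the mass of \<open>A\<close>. This bounds the two regions in the uniqueness argument.\<close>

lemma measure_le_sum_cells:
  fixes Y :: "'n::finite \<Rightarrow> real ^ 'd"
  assumes "inj Y" "A \<in> sets borel" "\<And>u k. u \<in> A \<Longrightarrow> u \<in> cell Y w k \<Longrightarrow> k \<in> S"
  shows "measure unif_cube A \<le> (\<Sum>k\<in>S. measure unif_cube (cell Y w k))"
proof -
  have "measure unif_cube A \<le> measure unif_cube (\<Union>k\<in>S. cell Y w k)"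
    using AE_unif_cube_cells[OF assms(1), of w] assms(2,3)
    by (intro unif_cube.finite_measure_mono_AE) auto
  also have "\<dots> \<le> (\<Sum>k\<in>S. measure unif_cube (cell Y w k))"
    by (intro unif_cube.finite_measure_subadditive_finite) auto
  finally show ?thesis .
qed

text \<open>The two sets are compared almost everywhere, because the default value of
  \<open>gradient\<close> off the cells might happen to be \<open>Y k\<close>.\<close>

lemma measure_gradient_vimage:
  fixes Y :: "'n::finite \<Rightarrow> real ^ 'd"
  assumes "inj Y"
  shows "measure unif_cube (gradient (wstar Y w) -` {Y k}) = measure unif_cube (cell Y w k)"
proof (rule unif_cube.finite_measure_eq_AE)
  show "AE u in unif_cube. (u \<in> gradient (wstar Y w) -` {Y k}) = (u \<in> cell Y w k)"
    using AE_unif_cube_cells[OF assms, of w]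
  proof eventually_elim
    case (elim u)
    then obtain j where j: "u \<in> cell Y w j" by blast
    then have "Y j = Y k \<longleftrightarrow> u \<in> cell Y w k"
      using assms j by (auto dest: injD cell_disjoint[OF j])
    then show ?case by (simp add: gradient_wstar_cell[OF j])
  qed
  show "gradient (wstar Y w) -` {Y k} \<in> sets unif_cube"
    using measurable_sets[OF gradient_wstar_measurable[OF assms], of "{Y k}" w] by simp
qed auto

text \<open>Almost every point lies in a cell, which yields the range condition and makes
  \<open>wstar Y w\<close> a potential for every \<open>w\<close>. What remains is the mass
  condition, with preimages replaced by cells.\<close>

lemma transport_weights_iff:
  fixes Y :: "'n::finite \<Rightarrow> real ^ 'd"
  assumes "inj Y"
  shows "transport_weights p Y w \<longleftrightarrow> (\<forall>k. measure unif_cube (cell Y w k) = p k)"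
proof -
  have "AE u in unif_cube. gradient (wstar Y w) u \<in> range Y"
    using AE_unif_cube_cells[OF assms, of w]
    by eventually_elim (auto simp: gradient_wstar_cell)
  moreover have "AE u in lborel. GDERIV (wstar Y w) u :> gradient (wstar Y w) u"
    using AE_cells[OF assms, of w]
    by eventually_elim (auto simp: gradient_wstar_cell GDERIV_wstar_cell)
  ultimately show ?thesis
    using convex_on_wstar[of Y w]
    by (auto simp: transport_weights_def Let_def measure_gradient_vimage[OF assms])
qed

lemma sets_discrete_measure: "sets (discrete_measure p Y) = sets borel"
  unfolding discrete_measure_def using sets.sigma_sets_eq[of "borel :: (real ^ 'd) measure"] by simp

lemma distr_gradient_wstar:
  fixes Y :: "'n::finite \<Rightarrow> real ^ 'd"
  assumes "inj Y" "\<And>k. measure unif_cube (cell Y w k) = p k"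
  shows "distr unif_cube borel (gradient (wstar Y w)) = discrete_measure p Y"
proof (rule measure_eqI)
  let ?\<phi> = "gradient (wstar Y w)"
  have m [measurable]: "?\<phi> \<in> borel_measurable borel"
    by (rule gradient_wstar_measurable[OF assms(1)])
  fix A assume "A \<in> sets (distr unif_cube borel ?\<phi>)"
  then have A [measurable]: "A \<in> sets borel" by simp
  have "emeasure (distr unif_cube borel ?\<phi>) A = (\<integral>\<^sup>+x. indicator A x \<partial>distr unif_cube borel ?\<phi>)"
    by simp
  also have "\<dots> = (\<integral>\<^sup>+u. indicator A (?\<phi> u) \<partial>unif_cube)"
    by (intro nn_integral_distr) measurable
  \<comment> \<open>Almost every \<open>u\<close> lies in exactly one cell, which selects a single
    summand.\<close>
  also have "\<dots> = (\<integral>\<^sup>+u. (\<Sum>k\<in>UNIV. indicator A (Y k) * indicator (cell Y w k) u) \<partial>unif_cube)"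
  proof (rule nn_integral_cong_AE)
    show "AE u in unif_cube. indicator A (?\<phi> u)
        = (\<Sum>k\<in>UNIV. indicator A (Y k) * indicator (cell Y w k) u :: ennreal)"
      using AE_unif_cube_cells[OF assms(1), of w]
    proof eventually_elim
      case (elim u)
      then obtain j where j: "u \<in> cell Y w j" by blast
      show ?case
        by (simp only: gradient_wstar_cell[OF j] sum_indicator_cell[OF j, of "\<lambda>k. indicator A (Y k)"])
    qed
  qed
  also have "\<dots> = (\<Sum>k\<in>UNIV. indicator A (Y k) * emeasure unif_cube (cell Y w k))"
    by (subst nn_integral_sum) (auto simp: nn_integral_cmult_indicator)
  also have "\<dots> = emeasure (discrete_measure p Y) A"
    by (simp add: emeasure_discrete_measure unif_cube.emeasure_eq_measure assms(2) mult.commute)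
  finally show "emeasure (distr unif_cube borel ?\<phi>) A = emeasure (discrete_measure p Y) A" .
qed (simp add: sets_discrete_measure)

subsection \<open>The dual functional\<close>

lemma Phi_subgradient:
  fixes Y :: "'n::finite \<Rightarrow> real ^ 'd"
  assumes "inj Y"
  shows "Phi unif_cube Y w - (\<Sum>k\<in>UNIV. (v $ k - w $ k) * measure unif_cube (cell Y w k))
    \<le> Phi unif_cube Y v"
proof -
  \<comment> \<open>On cell \<open>k\<close>, subtracting \<open>?g\<close> turns
    \<open>wstar Y w\<close> into the \<open>k\<close>-th affine function for the weights
    \<open>v\<close>.\<close>
  let ?g = "\<lambda>u. \<Sum>k\<in>UNIV. (v $ k - w $ k) * indicator (cell Y w k) u"
  have int: "integrable unif_cube ?g"
    by (intro Bochner_Integration.integrable_sum integrable_mult_right integrable_real_indicator)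
      (auto simp: unif_cube.emeasure_eq_measure)
  have "Phi unif_cube Y w - (\<Sum>k\<in>UNIV. (v $ k - w $ k) * measure unif_cube (cell Y w k))
      = (LINT u|unif_cube. wstar Y w u) - (LINT u|unif_cube. ?g u)"
    unfolding Phi_def
    by (subst Bochner_Integration.integral_sum)
      (auto intro!: integrable_real_indicator simp: unif_cube.emeasure_eq_measure)
  also have "\<dots> = (LINT u|unif_cube. wstar Y w u - ?g u)"
    by (rule Bochner_Integration.integral_diff[symmetric, OF integrable_wstar int])
  also have "\<dots> \<le> Phi unif_cube Y v"
    unfolding Phi_def
  proof (rule integral_mono_AE)
    show "AE u in unif_cube. wstar Y w u - ?g u \<le> wstar Y v u"
      using AE_unif_cube_cells[OF assms, of w]
    proof eventually_elim
      case (elim u)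
      then obtain j where j: "u \<in> cell Y w j" by blast
      show ?case
        using wstar_ge[of u Y j v]
        by (simp add: wstar_cell[OF j] sum_indicator_cell[OF j, of "\<lambda>k. v $ k - w $ k"])
    qed
  qed (intro Bochner_Integration.integrable_diff integrable_wstar int)+
  finally show ?thesis .
qed

lemma Phi_convex_combination:
  fixes Y :: "'n::finite \<Rightarrow> real ^ 'd"
  assumes "0 \<le> a" "0 \<le> b" "a + b = 1"
  shows "Phi unif_cube Y (a *\<^sub>R v + b *\<^sub>R w) \<le> a * Phi unif_cube Y v + b * Phi unif_cube Y w"
proof -
  have "Phi unif_cube Y (a *\<^sub>R v + b *\<^sub>R w) \<le> (LINT u|unif_cube. a * wstar Y v u + b * wstar Y w u)"
    unfolding Phi_def
    by (intro integral_mono wstar_convex_combination(2)[OF assms]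
        Bochner_Integration.integrable_add integrable_mult_right integrable_wstar)
  also have "\<dots> = a * Phi unif_cube Y v + b * Phi unif_cube Y w"
    by (simp add: Phi_def integrable_wstar)
  finally show ?thesis .
qed

lemma convex_on_dual_functional:
  fixes Y :: "'n::finite \<Rightarrow> real ^ 'd"
  shows "convex_on UNIV (\<lambda>v. Phi unif_cube Y v + (\<Sum>k\<in>UNIV. p k * v $ k))"
proof (rule convex_onI)
  fix t :: real and v w :: "real ^ 'n"
  assume t: "0 < t" "t < 1"
  have "(\<Sum>k\<in>UNIV. p k * ((1 - t) *\<^sub>R v + t *\<^sub>R w) $ k)
      = (1 - t) * (\<Sum>k\<in>UNIV. p k * v $ k) + t * (\<Sum>k\<in>UNIV. p k * w $ k)"
    by (simp add: sum_distrib_left sum.distrib[symmetric] algebra_simps)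
  moreover have "Phi unif_cube Y ((1 - t) *\<^sub>R v + t *\<^sub>R w)
      \<le> (1 - t) * Phi unif_cube Y v + t * Phi unif_cube Y w"
    using t by (intro Phi_convex_combination) auto
  ultimately show "Phi unif_cube Y ((1 - t) *\<^sub>R v + t *\<^sub>R w)
      + (\<Sum>k\<in>UNIV. p k * ((1 - t) *\<^sub>R v + t *\<^sub>R w) $ k)
      \<le> (1 - t) * (Phi unif_cube Y v + (\<Sum>k\<in>UNIV. p k * v $ k))
        + t * (Phi unif_cube Y w + (\<Sum>k\<in>UNIV. p k * w $ k))"
    by (simp add: algebra_simps)
qed auto

section \<open>Coercivity and existence of a minimiser\<close>

lemma Phi_shift:
  fixes Y :: "'n::finite \<Rightarrow> real ^ 'd"
  assumes "\<And>k. v $ k = w $ k + c"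
  shows "Phi unif_cube Y v = Phi unif_cube Y w - c"
proof -
  have "wstar Y v = (\<lambda>u. wstar Y w u - c)"
    using wstar_shift[OF assms] by (rule ext)
  then have "Phi unif_cube Y v = (LINT u|unif_cube. wstar Y w u - c)"
    by (simp add: Phi_def)
  also have "\<dots> = Phi unif_cube Y w - c"
    by (simp add: Phi_def integrable_wstar unif_cube.prob_space[simplified])
  finally show ?thesis .
qed

lemma Phi_ge_neg_weight:
  fixes Y :: "'n::finite \<Rightarrow> real ^ 'd"
  shows "- (real CARD('d) * norm (Y k)) - w $ k \<le> Phi unif_cube Y w"
proof -
  have "- (real CARD('d) * norm (Y k)) - w $ k
      = (LINT u|(unif_cube :: (real ^ 'd) measure). - (real CARD('d) * norm (Y k)) - w $ k)"
    by (simp add: unif_cube.prob_space[simplified])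
  also have "\<dots> \<le> Phi unif_cube Y w"
    unfolding Phi_def
  proof (rule integral_mono_AE)
    show "AE u in unif_cube. - (real CARD('d) * norm (Y k)) - w $ k \<le> wstar Y w u"
      using AE_unif_cube_bounded_inner[of "Y k"]
    proof eventually_elim
      case (elim u)
      then show ?case using wstar_ge[of u Y k w] by linarith
    qed
  qed (auto intro: integrable_wstar)
  finally show ?thesis .
qed

text \<open>Since \<open>p\<close> sums to 1, adding a constant to all weights does not change the
  functional, so the least weight may be taken as 0. The functional then grows at least linearly in
  each weight, and outside a compact box it is no smaller than at 0.\<close>

lemma dual_functional_minimum_exists:
  fixes Y :: "'n::finite \<Rightarrow> real ^ 'd"
  assumes p: "\<And>k. p k > 0" "(\<Sum>k\<in>UNIV. p k) = 1"
  shows "\<exists>w. \<forall>v. Phi unif_cube Y w + (\<Sum>k\<in>UNIV. p k * w $ k)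
    \<le> Phi unif_cube Y v + (\<Sum>k\<in>UNIV. p k * v $ k)"
proof -
  define F where "F v = Phi unif_cube Y v + (\<Sum>k\<in>UNIV. p k * v $ k)" for v
  define R where "R = (\<Sum>k\<in>UNIV. real CARD('d) * norm (Y k))"
  \<comment> \<open>The corner solves \<open>p k * b $ k - R = F 0\<close>: beyond it the lower
    bound \<open>F_ge\<close> exceeds \<open>F 0\<close>.\<close>
  define b :: "real ^ 'n" where "b = (\<chi> k. (F 0 + R) / p k)"
  have R: "real CARD('d) * norm (Y k) \<le> R" for k
    unfolding R_def by (rule member_le_sum[of k UNIV "\<lambda>k. real CARD('d) * norm (Y k)"]) auto
  \<comment> \<open>The zero weight at \<open>j\<close> bounds \<open>Phi\<close> below by
    \<open>- R\<close>; the weighted sum has nonnegative terms and dominates each of them.\<close>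
  have F_ge: "p k * v $ k - R \<le> F v" if v: "\<And>k. v $ k \<ge> 0" "v $ j = 0" for v j k
  proof -
    have "p k * v $ k \<le> (\<Sum>k\<in>UNIV. p k * v $ k)"
      using p v by (intro member_le_sum[of k UNIV "\<lambda>k. p k * v $ k"]) (auto intro: mult_nonneg_nonneg less_imp_le)
    then show ?thesis
      using Phi_ge_neg_weight[of Y j v] R[of j] v(2) unfolding F_def by linarith
  qed
  \<comment> \<open>This makes the corner nonnegative, so that 0 lies in the box.\<close>
  have F0: "0 \<le> F 0 + R" using F_ge[of 0] by simp
  have "continuous_on UNIV F"
    using convex_on_dual_functional[of Y p] convex_on_continuous open_UNIV
    unfolding F_def by blast
  then have "continuous_on (cbox 0 b) F" using continuous_on_subset by blast
  moreover have "0 \<in> cbox 0 b"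
    using F0 p(1) by (auto simp: mem_box_cart b_def less_imp_le)
  ultimately obtain w where w: "w \<in> cbox 0 b" "\<And>v. v \<in> cbox 0 b \<Longrightarrow> F w \<le> F v"
    using continuous_attains_inf[of "cbox 0 b" F] compact_cbox by blast
  have "F w \<le> F v" for v
  proof -
    have "Min (range (($) v)) \<in> range (($) v)" by (rule Min_in) auto
    then obtain j where j: "Min (range (($) v)) = v $ j" by blast
    have j_le: "v $ j \<le> v $ k" for k
      by (simp flip: j)
    define v' :: "real ^ 'n" where "v' = (\<chi> k. v $ k - v $ j)"
    have v': "v' $ k \<ge> 0" "v' $ j = 0" "v' $ k = v $ k + (- v $ j)" for k
      using j_le[of k] by (auto simp: v'_def)
    have "F v' = F v"
      unfolding F_def Phi_shift[OF v'(3)] v'(3)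
      by (simp add: ring_distribs sum.distrib p sum_distrib_right[symmetric] sum_subtractf)
    moreover have "F w \<le> F v'"
    proof (cases "v' \<in> cbox 0 b")
      case True
      then show ?thesis by (rule w(2))
    next
      case False
      \<comment> \<open>As \<open>v'\<close> is nonnegative, only the upper bound of the box can
        fail.\<close>
      then obtain k where "v' $ k > (F 0 + R) / p k"
        using v'(1) by (auto simp: mem_box_cart b_def not_le)
      then have "F 0 + R < p k * v' $ k" using p(1)[of k] by (simp add: field_simps)
      then have "F 0 \<le> F v'" using F_ge[OF v'(1,2), of k] by linarith
      moreover have "F w \<le> F 0" using w(2) \<open>0 \<in> cbox 0 b\<close> by blast
      ultimately show ?thesis by linarith
    qed
    ultimately show ?thesis by simp
  qed
  then show ?thesis unfolding F_def by blast
qed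

section \<open>From minimisers to weights with the prescribed masses\<close>

lemma minimum_imp_cell_measure_le:
  fixes Y :: "'n::finite \<Rightarrow> real ^ 'd"
  assumes "inj Y" and
    min: "\<And>v. Phi unif_cube Y w + (\<Sum>k\<in>UNIV. p k * w $ k)
      \<le> Phi unif_cube Y v + (\<Sum>k\<in>UNIV. p k * v $ k)"
  shows "measure unif_cube (cell Y w k) \<le> p k"
proof -
  \<comment> \<open>Raising the \<open>k\<close>-th weight shrinks cell \<open>k\<close>;
    \<open>Suc\<close> keeps the increment positive at \<open>n = 0\<close>.\<close>
  define v :: "nat \<Rightarrow> real ^ 'n" where "v n = w + axis k (inverse (real (Suc n)))" for n
  have v_k: "v n $ k = w $ k + inverse (real (Suc n))" for n
    by (simp add: v_def)
  have v_j: "j \<noteq> k \<Longrightarrow> v n $ j = w $ j" for n j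
    by (simp add: v_def axis_def)
  have cell_v: "u \<in> cell Y (v n) k \<longleftrightarrow>
      (\<forall>j. j \<noteq> k \<longrightarrow> u \<bullet> Y j - w $ j + inverse (real (Suc n)) < u \<bullet> Y k - w $ k)" for u n
  proof -
    have "u \<bullet> Y j - v n $ j < u \<bullet> Y k - v n $ k \<longleftrightarrow>
        u \<bullet> Y j - w $ j + inverse (real (Suc n)) < u \<bullet> Y k - w $ k" if "j \<noteq> k" for j
      using v_j[OF that, of n] v_k[of n] by linarith
    then show ?thesis unfolding cell_def by blast
  qed
  \<comment> \<open>The subgradient inequality is applied at \<open>v n\<close> and combined with
    minimality at \<open>w\<close>. This bounds increment times mass by increment times
    \<open>p k\<close>.\<close>
  have "measure unif_cube (cell Y (v n) k) \<le> p k" for n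
  proof -
    let ?t = "inverse (real (Suc n))"
    have 1: "(\<Sum>j\<in>UNIV. p j * v n $ j) = (\<Sum>j\<in>UNIV. p j * w $ j) + p k * ?t"
    proof -
      have "(\<Sum>j\<in>UNIV. p j * v n $ j) = (\<Sum>j\<in>UNIV. p j * w $ j + (if j = k then p k * ?t else 0))"
        by (intro sum.cong) (auto simp: v_k v_j algebra_simps)
      then show ?thesis by (simp add: sum.distrib)
    qed
    have 2: "(\<Sum>j\<in>UNIV. (w $ j - v n $ j) * measure unif_cube (cell Y (v n) j))
        = - ?t * measure unif_cube (cell Y (v n) k)"
    proof -
      have "(\<Sum>j\<in>UNIV. (w $ j - v n $ j) * measure unif_cube (cell Y (v n) j))
          = (\<Sum>j\<in>UNIV. if j = k then - ?t * measure unif_cube (cell Y (v n) k) else 0)"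
        by (intro sum.cong) (auto simp: v_k v_j)
      then show ?thesis by simp
    qed
    have "?t * measure unif_cube (cell Y (v n) k) \<le> ?t * p k"
      using Phi_subgradient[OF assms(1), of "v n" w] min[of "v n"] 1 2 by (simp only: mult.commute)
    then show ?thesis by simp
  qed
  \<comment> \<open>The shrunken cells increase to the cell of \<open>w\<close>, so continuity from
    below transfers the bound.\<close>
  moreover have "(\<lambda>n. measure unif_cube (cell Y (v n) k)) \<longlonglongrightarrow> measure unif_cube (\<Union>n. cell Y (v n) k)"
  proof (rule unif_cube.finite_Lim_measure_incseq)
    show "incseq (\<lambda>n. cell Y (v n) k)"
    proof (rule monoI, rule subsetI)
      fix m n :: nat and u assume "m \<le> n" and u: "u \<in> cell Y (v m) k"
      have "inverse (real (Suc n)) \<le> inverse (real (Suc m))"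
        using \<open>m \<le> n\<close> by (simp add: le_imp_inverse_le)
      then show "u \<in> cell Y (v n) k" using u unfolding cell_v by (meson add_left_mono order_le_less_trans)
    qed
  qed auto
  moreover have "(\<Union>n. cell Y (v n) k) = cell Y w k"
  proof (intro equalityI subsetI)
    fix u assume "u \<in> (\<Union>n. cell Y (v n) k)"
    then obtain n where n: "u \<in> cell Y (v n) k" by blast
    have pos: "inverse (real (Suc n)) > 0" by simp
    have "u \<bullet> Y j - w $ j < u \<bullet> Y k - w $ k" if "j \<noteq> k" for j
      using n[unfolded cell_v, rule_format, OF that] pos by linarith
    then show "u \<in> cell Y w k" by (simp add: cell_def)
  next
    fix u assume u: "u \<in> cell Y w k"
    \<comment> \<open>There are finitely many competitors, so one increment lies below all the
      positive margins.\<close>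
    have "\<forall>\<^sub>F n in sequentially. \<forall>j\<in>-{k}. inverse (real (Suc n)) < (u \<bullet> Y k - w $ k) - (u \<bullet> Y j - w $ j)"
    proof (subst eventually_ball_finite_distrib, simp, rule ballI)
      fix j assume "j \<in> -{k}"
      then have "0 < (u \<bullet> Y k - w $ k) - (u \<bullet> Y j - w $ j)" using u by (simp add: cell_def)
      then show "\<forall>\<^sub>F n in sequentially. inverse (real (Suc n)) < (u \<bullet> Y k - w $ k) - (u \<bullet> Y j - w $ j)"
        using LIMSEQ_inverse_real_of_nat order_tendstoD(2) by blast
    qed
    then obtain n where "\<forall>j\<in>-{k}. inverse (real (Suc n)) < (u \<bullet> Y k - w $ k) - (u \<bullet> Y j - w $ j)"
      by (auto simp: eventually_sequentially)
    then have "u \<bullet> Y j - w $ j + inverse (real (Suc n)) < u \<bullet> Y k - w $ k" if "j \<noteq> k" for j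
      using that by (metis Compl_iff singletonD less_diff_eq add.commute)
    then show "u \<in> (\<Union>n. cell Y (v n) k)" using cell_v by blast
  qed
  ultimately show ?thesis by (simp add: LIMSEQ_le_const2)
qed

lemma transport_weights_exist:
  fixes Y :: "'n::finite \<Rightarrow> real ^ 'd"
  assumes "inj Y" "\<And>k. p k > 0" "(\<Sum>k\<in>UNIV. p k) = 1"
  shows "\<exists>w. transport_weights p Y w"
proof -
  obtain w where "\<And>v. Phi unif_cube Y w + (\<Sum>k\<in>UNIV. p k * w $ k)
      \<le> Phi unif_cube Y v + (\<Sum>k\<in>UNIV. p k * v $ k)"
    using dual_functional_minimum_exists[OF assms(2,3), of Y] by blast
  then have le: "measure unif_cube (cell Y w k) \<le> p k" for k
    by (rule minimum_imp_cell_measure_le[OF assms(1)])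
  have "measure unif_cube (cell Y w k) = p k" for k
  proof (rule ccontr)
    assume "measure unif_cube (cell Y w k) \<noteq> p k"
    then have "(\<Sum>k\<in>UNIV. measure unif_cube (cell Y w k)) < (\<Sum>k\<in>UNIV. p k)"
      using le by (intro sum_strict_mono_ex1) (auto simp: less_le)
    then show False using sum_measure_cells[OF assms(1), of w] assms(3) by simp
  qed
  then show ?thesis using transport_weights_iff[OF assms(1)] by blast
qed

lemma transport_weights_minimize:
  fixes Y :: "'n::finite \<Rightarrow> real ^ 'd"
  assumes "inj Y" "\<And>k. measure unif_cube (cell Y w k) = p k"
  shows "Phi unif_cube Y w + (\<Sum>k\<in>UNIV. p k * w $ k)
    \<le> Phi unif_cube Y v + (\<Sum>k\<in>UNIV. p k * v $ k)"
  using Phi_subgradient[OF assms(1), of w v]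
  by (simp add: assms(2) algebra_simps sum_subtractf)

section \<open>Uniqueness up to an additive constant\<close>

lemma transport_weights_unique:
  fixes Y :: "'n::finite \<Rightarrow> real ^ 'd"
  assumes "inj Y" "\<And>k. p k > 0" "(\<Sum>k\<in>UNIV. p k) = 1"
    and w: "\<And>k. measure unif_cube (cell Y w k) = p k"
    and v: "\<And>k. measure unif_cube (cell Y v k) = p k"
  shows "\<exists>c. \<forall>k. v $ k = w $ k + c"
proof (rule ccontr)
  assume nc: "\<not> ?thesis"
  define c where "c = Min (range (\<lambda>k. v $ k - w $ k))"
  define S where "S = {k. v $ k = w $ k + c}"
  have c_le: "c \<le> v $ k - w $ k" for k
    unfolding c_def by (rule Min_le) auto
  have "c \<in> range (\<lambda>k. v $ k - w $ k)"
    unfolding c_def by (rule Min_in) auto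
  then obtain k where "c = v $ k - w $ k" by blast
  then have "k \<in> S" by (simp add: S_def)
  then have S_ne: "S \<noteq> {}" by blast
  have T_ne: "-S \<noteq> {}" using nc by (auto simp: S_def)
  \<comment> \<open>The smallest excess over \<open>c\<close> outside \<open>S\<close>, positive
    because \<open>-S\<close> is finite and nonempty.\<close>
  define e where "e = Min ((\<lambda>k. v $ k - w $ k - c) ` (-S))"
  have e_le: "w $ k + c + e \<le> v $ k" if "k \<notin> S" for k
  proof -
    have "e \<le> v $ k - w $ k - c" unfolding e_def using that by (intro Min_le) auto
    then show ?thesis by linarith
  qed
  have "v $ k - w $ k - c > 0" if "k \<notin> S" for k
    using that c_le[of k] unfolding S_def mem_Collect_eq by linarith
  then have e_pos: "e > 0"
    unfolding e_def using T_ne by (subst Min_gr_iff) auto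
  \<comment> \<open>In terms of best scores under \<open>w\<close>, \<open>P\<close> says that
    \<open>-S\<close> leads \<open>S\<close> by less than \<open>e\<close>, and \<open>Q\<close>
    that \<open>-S\<close> strictly leads. The strip is \<open>P \<inter> Q\<close>.\<close>
  define P where "P = (\<Union>k\<in>S. \<Inter>j\<in>-S. {u. u \<bullet> Y j - w $ j - e < u \<bullet> Y k - w $ k})"
  define Q where "Q = (\<Union>j\<in>-S. \<Inter>k\<in>S. {u. u \<bullet> Y k - w $ k < u \<bullet> Y j - w $ j})"
  have "open P" "open Q"
    unfolding P_def Q_def by (auto intro!: open_UN open_INT open_Collect_less continuous_intros)
  then have [measurable]: "P \<in> sets borel" "Q \<in> sets borel" by auto
  \<comment> \<open>If the best index of \<open>S\<close> trails some outside index by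
    \<open>e\<close> or more, that index beats all of \<open>S\<close>.\<close>
  have cover: "P \<union> Q = UNIV"
  proof (intro equalityI subsetI UNIV_I)
    fix u
    let ?f = "\<lambda>k. u \<bullet> Y k - w $ k"
    have "Max (?f ` S) \<in> ?f ` S" using S_ne by (intro Max_in) auto
    then obtain k where k: "k \<in> S" "Max (?f ` S) = ?f k" by blast
    have k_max: "?f i \<le> ?f k" if "i \<in> S" for i
      unfolding k(2)[symmetric] using that by (intro Max_ge) auto
    show "u \<in> P \<union> Q"
    proof (cases "\<forall>j\<in>-S. ?f j - e < ?f k")
      case True
      then show ?thesis using k(1) by (auto simp: P_def)
    next
      case False
      then obtain j where j: "j \<in> -S" "?f k + e \<le> ?f j" by force
      have "?f i < ?f j" if "i \<in> S" for i
        using k_max[OF that] j(2) e_pos by linarith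
      then show ?thesis using j(1) by (auto simp: Q_def)
    qed
  qed
  \<comment> \<open>Passing to \<open>v\<close> adds \<open>c\<close> to the weights in
    \<open>S\<close> and at least \<open>c + e\<close> to the others, so on \<open>P\<close> a
    member of \<open>S\<close> beats every outside index.\<close>
  have P_le: "measure unif_cube P \<le> sum p S"
  proof -
    have "measure unif_cube P \<le> (\<Sum>k\<in>S. measure unif_cube (cell Y v k))"
    proof (rule measure_le_sum_cells[OF assms(1)])
      fix u j assume u: "u \<in> P" "u \<in> cell Y v j"
      obtain k where k: "k \<in> S" "\<And>j. j \<notin> S \<Longrightarrow> u \<bullet> Y j - w $ j - e < u \<bullet> Y k - w $ k"
        using u(1) by (auto simp: P_def)
      show "j \<in> S"
      proof (rule ccontr)
        assume j: "j \<notin> S"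
        then have "u \<bullet> Y k - v $ k < u \<bullet> Y j - v $ j" using u(2) k(1) by (auto simp: cell_def)
        moreover have "v $ k = w $ k + c" using k(1) by (simp add: S_def)
        ultimately show False using k(2)[OF j] e_le[OF j] by linarith
      qed
    qed simp
    then show ?thesis by (simp add: v)
  qed
  \<comment> \<open>Here the cells of \<open>w\<close> are used: on \<open>Q\<close> an outside
    index already wins.\<close>
  have Q_le: "measure unif_cube Q \<le> sum p (-S)"
  proof -
    have "measure unif_cube Q \<le> (\<Sum>k\<in>-S. measure unif_cube (cell Y w k))"
    proof (rule measure_le_sum_cells[OF assms(1)])
      fix u k assume u: "u \<in> Q" "u \<in> cell Y w k"
      then obtain j where "j \<notin> S" "\<And>k. k \<in> S \<Longrightarrow> u \<bullet> Y k - w $ k < u \<bullet> Y j - w $ j"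
        by (auto simp: Q_def)
      then show "k \<in> -S" using u(2) by (force simp: cell_def)
    qed simp
    then show ?thesis by (simp add: w)
  qed
  have p_sum: "sum p S + sum p (-S) = 1"
    using assms(3) by (simp add: Compl_eq_Diff_UNIV sum.subset_diff[of S UNIV p])
  have p_pos: "sum p S > 0" "sum p (-S) > 0"
    using S_ne T_ne assms(2) by (auto intro!: sum_pos)
  \<comment> \<open>By inclusion-exclusion the two masses sum to 1 plus the mass of the overlap,
    while their upper bounds sum to 1.\<close>
  have "measure unif_cube P + measure unif_cube Q
      = measure unif_cube (P \<union> Q) + measure unif_cube (P \<inter> Q)"
    by (subst measure_Un3) (auto simp: unif_cube.fmeasurable_eq_sets)
  also have "measure unif_cube (P \<union> Q) = 1"
    using unif_cube.prob_space cover by simp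
  finally have split: "measure unif_cube P + measure unif_cube Q = 1 + measure unif_cube (P \<inter> Q)" .
  \<comment> \<open>Each mass is at least 1 minus the bound for the other, which is the positive
    total weight of its own index set.\<close>
  have "measure unif_cube P > 0" "measure unif_cube Q > 0"
    using split P_le Q_le p_sum p_pos measure_nonneg[of unif_cube "P \<inter> Q"] by linarith+
  then have "measure unif_cube (P \<inter> Q) > 0"
    using \<open>open P\<close> \<open>open Q\<close> cover open_cover_unit_cube_overlap by blast
  then show False using split P_le Q_le p_sum by linarith
qed

theorem proposition6:
  fixes Y :: "'n::finite \<Rightarrow> real ^ 'd" and p :: "'n \<Rightarrow> real"
  assumes "inj Y" and "\<And>k. p k > 0" and "(\<Sum>k\<in>UNIV. p k) = 1"
  shows "(\<exists>w. transport_weights p Y w \<and>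
            (\<forall>w'. transport_weights p Y w' \<longleftrightarrow> (\<exists>c. \<forall>k. w' $ k = w $ k + c))) \<and>
         (\<forall>w. transport_weights p Y w \<longrightarrow>
            gradient (wstar Y w) \<in> borel_measurable unif_cube \<and>
            distr unif_cube borel (gradient (wstar Y w)) = discrete_measure p Y) \<and>
         convex_on UNIV (\<lambda>v. Phi unif_cube Y v + (\<Sum>k\<in>UNIV. p k * v $ k)) \<and>
         (\<forall>w. transport_weights p Y w \<longrightarrow>
            (\<forall>v. Phi unif_cube Y w + (\<Sum>k\<in>UNIV. p k * w $ k)
               \<le> Phi unif_cube Y v + (\<Sum>k\<in>UNIV. p k * v $ k)))"
proof (intro conjI allI impI)
  note iff = transport_weights_iff[OF assms(1)]
  obtain w where w: "transport_weights p Y w"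
    using transport_weights_exist[OF assms] by blast
  have "transport_weights p Y w' \<longleftrightarrow> (\<exists>c. \<forall>k. w' $ k = w $ k + c)" for w'
  proof
    assume "transport_weights p Y w'"
    then show "\<exists>c. \<forall>k. w' $ k = w $ k + c"
      using transport_weights_unique[OF assms] w unfolding iff by blast
  next
    assume "\<exists>c. \<forall>k. w' $ k = w $ k + c"
    then obtain c where "\<And>k. w' $ k = w $ k + c" by blast
    \<comment> \<open>A common shift of the weights leaves every cell unchanged.\<close>
    then show "transport_weights p Y w'"
      using w unfolding iff by (simp add: cell_shift)
  qed
  then show "\<exists>w. transport_weights p Y w \<and>
      (\<forall>w'. transport_weights p Y w' \<longleftrightarrow> (\<exists>c. \<forall>k. w' $ k = w $ k + c))"
    using w by blast
  fix w assume "transport_weights p Y w"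
  then have w: "\<And>k. measure unif_cube (cell Y w k) = p k" by (simp add: iff)
  show "gradient (wstar Y w) \<in> borel_measurable unif_cube"
    using gradient_wstar_measurable[OF assms(1), of w] by (simp add: measurable_def)
  show "distr unif_cube borel (gradient (wstar Y w)) = discrete_measure p Y"
    by (rule distr_gradient_wstar[OF assms(1) w])
  show "Phi unif_cube Y w + (\<Sum>k\<in>UNIV. p k * w $ k)
      \<le> Phi unif_cube Y v + (\<Sum>k\<in>UNIV. p k * v $ k)" for v
    by (rule transport_weights_minimize[OF assms(1) w])
next
  show "convex_on UNIV (\<lambda>v. Phi unif_cube Y v + (\<Sum>k\<in>UNIV. p k * v $ k))"
    by (rule convex_on_dual_functional)
qed

end
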